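(* Let $\mathcal{D}=\vartheta^n+\sum_{k=1}^m z^kP_k(\vartheta)$ with $P_k\in\mathbb{C}[\vartheta]$ of degree at most $n$, $\vartheta=z\frac{d}{dz}$, and write $\mathcal{D}=\sum_{i=0}^n c_i(z)\vartheta^i$ with $c_i\in\mathbb{C}[z]$. Suppose $\mathcal{D}z=(-1)^nz\,\mathcal{D}^{\vee}$. Define \[ P(z):=\exp\left(\frac{2}{n}\int\frac{c_{n-1}(z)}{z\,c_n(z)}\,dz\right),\qquad P(0)=1. \] Then $P(z)$ is a polynomial; in fact $P(z)=c_n(z)$.
   Context: Here $\partial=d/dz$, $\vartheta=z\partial$, and operators are elements of $\mathbb{C}(z)[\partial]$ with $\partial a=a'+a\partial$ for $a\in\mathbb{C}(z)$. For $L=\sum_{i=0}^n a_i\partial^i$, its dual is $L^{\vee}=\sum_{i=0}^n(-1)^i\partial^i a_i$, with $\partial^k a=\sum_{j=0}^k\binom{k}{j}a^{(j)}\partial^{k-j}$. *)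

theory Defs
  imports
    "HOL-Computational_Algebra.Field_as_Ring"
    "HOL-Computational_Algebra.Polynomial_Factorial"
    "HOL-Complex_Analysis.Complex_Analysis"
begin

section \<open>The differential field of rational functions\<close>

lemma fderiv_respects:
  fixes p q P Q :: "complex poly"
  assumes "p * Q = P * q"
  shows "(pderiv p * q - p * pderiv q) * Q\<^sup>2 = (pderiv P * Q - P * pderiv Q) * q\<^sup>2"
proof -
  have e: "p * pderiv Q + Q * pderiv p = P * pderiv q + q * pderiv P"
    using arg_cong[OF assms, of pderiv] by (simp add: pderiv_mult)
  have "(pderiv p * q - p * pderiv q) * Q\<^sup>2 - (pderiv P * Q - P * pderiv Q) * q\<^sup>2
      = q * Q * ((p * pderiv Q + Q * pderiv p) - (P * pderiv q + q * pderiv P))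
        + (pderiv q * Q + q * pderiv Q) * (P * q - p * Q)"
    by (simp add: algebra_simps power2_eq_square)
  also have "\<dots> = 0"
    using assms e by simp
  finally show ?thesis by simp
qed

definition fderiv :: "complex poly fract \<Rightarrow> complex poly fract"
  where "fderiv x = (case quot_of_fract x of
    (p, q) \<Rightarrow> Fract (pderiv p * q - p * pderiv q) (q\<^sup>2))"

lemma fderiv_Fract:
  assumes "q \<noteq> 0"
  shows "fderiv (Fract p q) = Fract (pderiv p * q - p * pderiv q) (q\<^sup>2)"
proof -
  obtain P Q where PQ: "quot_of_fract (Fract p q) = (P, Q)" by force
  then have Q: "Q \<noteq> 0"
    using snd_quot_of_fract_nonzero[of "Fract p q"] by simp
  have "Fract P Q = Fract p q"
    using quot_to_fract_quot_of_fract[of "Fract p q"] by (simp add: PQ quot_to_fract_def)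
  then have "P * q = p * Q"
    using assms Q by (simp add: eq_fract)
  from fderiv_respects[OF this] show ?thesis
    using assms Q by (simp add: fderiv_def PQ eq_fract)
qed

lemma fderiv_to_fract: "fderiv (to_fract p) = to_fract (pderiv p)"
  by (simp add: to_fract_def fderiv_Fract)

lemma fderiv_0 [simp]: "fderiv 0 = 0"
  using fderiv_to_fract[of 0] by simp

lemma fderiv_1 [simp]: "fderiv 1 = 0"
  using fderiv_to_fract[of 1] by simp

lemma fderiv_add: "fderiv (a + b) = fderiv a + fderiv b"
  by (cases a, cases b)
     (simp add: fderiv_Fract eq_fract pderiv_add pderiv_mult algebra_simps power2_eq_square)

lemma fderiv_mult: "fderiv (a * b) = fderiv a * b + a * fderiv b"
  by (cases a, cases b)
     (simp add: fderiv_Fract eq_fract pderiv_mult algebra_simps power2_eq_square)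


section \<open>The ring of differential operators with rational coefficients\<close>

text \<open>
  The operator with coefficients \<open>a\<^sub>0, \<dots>, a\<^sub>n\<close> (functions written to the left of the powers of
  the derivation) is stored as the polynomial with these coefficients; only the additive
  structure is that of polynomials.
\<close>

typedef diffop = "UNIV :: complex poly fract poly set"
  morphisms coeffs_of Diffop ..

setup_lifting type_definition_diffop

text \<open>Left composition with the derivation, from \<open>\<partial> b = b' + b \<partial>\<close>.\<close>

definition dleft :: "complex poly fract poly \<Rightarrow> complex poly fract poly"
  where "dleft B = pCons 0 B + map_poly fderiv B"

definition dcomp ::
  "complex poly fract poly \<Rightarrow> complex poly fract poly \<Rightarrow> complex poly fract poly"
  where "dcomp A B = (\<Sum>i\<le>degree A. smult (coeff A i) ((dleft ^^ i) B))"

lemma coeff_map_fderiv [simp]: "coeff (map_poly fderiv B) i = fderiv (coeff B i)"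
  by (simp add: coeff_map_poly)

lemma dleft_0 [simp]: "dleft 0 = 0"
  by (simp add: dleft_def)

lemma dleft_add: "dleft (A + B) = dleft A + dleft B"
  by (simp add: poly_eq_iff dleft_def coeff_pCons fderiv_add split: nat.split)

lemma dleft_smult: "dleft (smult a B) = smult a (dleft B) + smult (fderiv a) B"
  by (simp add: poly_eq_iff dleft_def coeff_pCons fderiv_mult algebra_simps split: nat.split)

lemma dleft_sum: "dleft (sum f S) = (\<Sum>x\<in>S. dleft (f x))"
  by (induction S rule: infinite_finite_induct) (simp_all add: dleft_add)

lemma dleft_pow_0 [simp]: "(dleft ^^ i) 0 = 0"
  by (induction i) simp_all

lemma dleft_pow_add: "(dleft ^^ i) (A + B) = (dleft ^^ i) A + (dleft ^^ i) B"
  by (induction i) (simp_all add: dleft_add)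

lemma dcomp_upto:
  assumes "degree A \<le> N"
  shows "dcomp A B = (\<Sum>i\<le>N. smult (coeff A i) ((dleft ^^ i) B))"
  unfolding dcomp_def
  by (rule sum.mono_neutral_left) (use assms in \<open>auto simp: coeff_eq_0\<close>)

lemma dcomp_0_left [simp]: "dcomp 0 B = 0"
  by (simp add: dcomp_def)

lemma dcomp_add_left: "dcomp (A + A') B = dcomp A B + dcomp A' B"
proof -
  let ?N = "max (degree A) (degree A')"
  have "degree (A + A') \<le> ?N" by (rule degree_add_le_max)
  then show ?thesis
    by (simp add: dcomp_upto[of _ ?N] smult_add_left sum.distrib)
qed

lemma dcomp_add_right: "dcomp A (B + B') = dcomp A B + dcomp A B'"
  by (simp add: dcomp_def dleft_pow_add smult_add_right sum.distrib)

lemma dcomp_smult_left: "dcomp (smult a A) B = smult a (dcomp A B)"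
proof -
  have "degree (smult a A) \<le> degree A" by simp
  from dcomp_upto[OF this] show ?thesis
    by (simp add: dcomp_def poly_eq_iff coeff_sum sum_distrib_left mult.assoc)
qed

lemma dcomp_sum_left: "dcomp (sum f S) B = (\<Sum>x\<in>S. dcomp (f x) B)"
  by (induction S rule: infinite_finite_induct) (simp_all add: dcomp_add_left)

lemma dcomp_dleft: "dcomp (dleft A) B = dleft (dcomp A B)"
proof -
  let ?N = "degree A"
  have map: "degree (map_poly fderiv A) \<le> ?N"
    by (rule degree_le) (simp add: coeff_eq_0)
  have "dcomp (dleft A) B = dcomp (pCons 0 A) B + dcomp (map_poly fderiv A) B"
    by (simp add: dleft_def dcomp_add_left)
  also have "dcomp (pCons 0 A) B = (\<Sum>i\<le>Suc ?N. smult (coeff (pCons 0 A) i) ((dleft ^^ i) B))"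
    by (rule dcomp_upto) (simp add: degree_pCons_le)
  also have "\<dots> = (\<Sum>i\<le>?N. smult (coeff A i) (dleft ((dleft ^^ i) B)))"
    by (subst sum.atMost_Suc_shift) simp
  also have "dcomp (map_poly fderiv A) B
      = (\<Sum>i\<le>?N. smult (fderiv (coeff A i)) ((dleft ^^ i) B))"
    using dcomp_upto[OF map] by simp
  finally show ?thesis
    by (simp add: dcomp_def dleft_sum dleft_smult sum.distrib)
qed

lemma dcomp_dleft_pow: "dcomp ((dleft ^^ i) A) B = (dleft ^^ i) (dcomp A B)"
  by (induction i) (simp_all add: dcomp_dleft)

lemma dcomp_assoc: "dcomp (dcomp A B) C = dcomp A (dcomp B C)"
  by (simp add: dcomp_def[of A] dcomp_sum_left dcomp_smult_left dcomp_dleft_pow)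

lemma dleft_pow_1: "(dleft ^^ i) 1 = monom 1 i"
proof (induction i)
  case (Suc i)
  have "map_poly fderiv (monom 1 i) = 0"
    by (simp add: poly_eq_iff)
  with Suc show ?case
    by (simp add: dleft_def monom_Suc)
qed simp

lemma dcomp_1_left: "dcomp 1 B = B"
  by (simp add: dcomp_def)

lemma dcomp_1_right: "dcomp A 1 = A"
  by (simp add: dcomp_def dleft_pow_1 smult_monom poly_as_sum_of_monoms)

instantiation diffop :: ring_1
begin

lift_definition zero_diffop :: diffop is 0 .
lift_definition one_diffop :: diffop is 1 .
lift_definition plus_diffop :: "diffop \<Rightarrow> diffop \<Rightarrow> diffop" is "(+)" .
lift_definition minus_diffop :: "diffop \<Rightarrow> diffop \<Rightarrow> diffop" is "(-)" .
lift_definition uminus_diffop :: "diffop \<Rightarrow> diffop" is "uminus" .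
lift_definition times_diffop :: "diffop \<Rightarrow> diffop \<Rightarrow> diffop" is dcomp .

instance
  by standard
     (transfer, simp add: algebra_simps dcomp_assoc dcomp_1_left dcomp_1_right
        dcomp_add_left dcomp_add_right)+

end

text \<open>Multiplication by a rational function, as an operator of order \<open>0\<close>.\<close>

definition mul_op :: "complex poly fract \<Rightarrow> diffop"
  where "mul_op a = Diffop [:a:]"

abbreviation pmul_op :: "complex poly \<Rightarrow> diffop"
  where "pmul_op p \<equiv> mul_op (to_fract p)"

definition D_op :: diffop
  where "D_op = Diffop [:0, 1:]"

definition z_op :: diffop
  where "z_op = pmul_op [:0, 1:]"

definition theta :: diffop
  where "theta = z_op * D_op"

definition op_coeff :: "diffop \<Rightarrow> nat \<Rightarrow> complex poly fract"
  where "op_coeff L = coeff (coeffs_of L)"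

definition op_order :: "diffop \<Rightarrow> nat"
  where "op_order L = degree (coeffs_of L)"

lemma coeffs_of_Diffop [simp]: "coeffs_of (Diffop A) = A"
  by (simp add: Diffop_inverse)

lemma Diffop_add: "Diffop A + Diffop B = Diffop (A + B)"
  by (simp add: coeffs_of_inject[symmetric] plus_diffop.rep_eq)

lemma Diffop_mult: "Diffop A * Diffop B = Diffop (dcomp A B)"
  by (simp add: coeffs_of_inject[symmetric] times_diffop.rep_eq)

lemma Diffop_sum: "(\<Sum>i\<in>S. Diffop (f i)) = Diffop (\<Sum>i\<in>S. f i)"
  by (induction S rule: infinite_finite_induct)
     (simp_all add: zero_diffop_def Diffop_add)

lemma D_op_Diffop: "D_op * Diffop A = Diffop (dleft A)"
  by (simp add: D_op_def Diffop_mult dcomp_def)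

lemma D_op_mul_op: "D_op * mul_op a = mul_op (fderiv a) + mul_op a * D_op"
  by (simp add: mul_op_def D_op_Diffop, simp add: D_op_def Diffop_mult Diffop_add)
     (simp add: dcomp_def dleft_def map_poly_pCons)

lemma mul_op_add: "mul_op (a + b) = mul_op a + mul_op b"
  by (simp add: mul_op_def Diffop_add)

lemma mul_op_mult: "mul_op (a * b) = mul_op a * mul_op b"
  by (simp add: mul_op_def Diffop_mult dcomp_def)

lemma D_op_power: "D_op ^ i = Diffop (monom 1 i)"
proof (induction i)
  case 0
  show ?case by (simp add: one_diffop_def)
next
  case (Suc i)
  have "dleft (monom 1 i) = monom 1 (Suc i)"
    using dleft_pow_1[of "Suc i"] dleft_pow_1[of i] by simp
  with Suc show ?case by (simp add: D_op_Diffop)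
qed

lemma diffop_expand: "L = (\<Sum>i\<le>op_order L. mul_op (op_coeff L i) * D_op ^ i)"
proof -
  have "mul_op a * D_op ^ i = Diffop (monom a i)" for a i
    by (simp add: D_op_power mul_op_def Diffop_mult dcomp_def smult_monom)
  then show ?thesis
    by (simp add: Diffop_sum op_order_def op_coeff_def poly_as_sum_of_monoms coeffs_of_inverse)
qed

definition dual :: "diffop \<Rightarrow> diffop"
  where "dual L = (\<Sum>i\<le>op_order L. (-1) ^ i * D_op ^ i * mul_op (op_coeff L i))"

text \<open>Substitution of an operator into a polynomial with constant coefficients.\<close>

definition poly_op :: "complex poly \<Rightarrow> diffop \<Rightarrow> diffop"
  where "poly_op p A = (\<Sum>i\<le>degree p. pmul_op [:coeff p i:] * A ^ i)"


section \<open>The exponential of the logarithmic integral\<close>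

text \<open>
  The normalisation \<open>P(0) = 1\<close> makes \<open>0\<close> the base point of the integral. The path is the segment
  from \<open>0\<close> to \<open>z\<close>, so this is meant for \<open>z\<close> such that \<open>c n\<close> has no zero on that segment. The
  integrand is totalised to \<open>0\<close> at its removable singularity, which does not affect the integral.
\<close>

definition P_integrand :: "nat \<Rightarrow> (nat \<Rightarrow> complex poly) \<Rightarrow> complex \<Rightarrow> complex"
  where "P_integrand n c w = poly (c (n - 1)) w / (w * poly (c n) w)"

definition P_fun :: "nat \<Rightarrow> (nat \<Rightarrow> complex poly) \<Rightarrow> complex \<Rightarrow> complex"
  where "P_fun n c z = exp (2 / of_nat n * contour_integral (linepath 0 z) (P_integrand n c))"

end

theory Submission
  imports Defs
begin

text \<open>
  Write \<open>L = \<Sum>\<^sub>i a\<^sub>i \<partial>\<^sup>i\<close> of order \<open>n\<close>. Comparing the coefficients of \<open>\<partial>\<^sup>n\<^sup>-\<^sup>1\<close> in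
  \<open>L z = (-1)\<^sup>n z L\<^sup>\<or>\<close> gives \<open>n a\<^sub>n + 2 z a\<^sub>n\<^sub>-\<^sub>1 = n z a\<^sub>n'\<close>. Expanding \<open>\<vartheta>\<^sup>i\<close> to its two leading
  terms, \<open>a\<^sub>n = z\<^sup>n c\<^sub>n\<close> and \<open>a\<^sub>n\<^sub>-\<^sub>1 = z\<^sup>n\<^sup>-\<^sup>1 (c\<^sub>n\<^sub>-\<^sub>1 + n(n-1)/2 c\<^sub>n)\<close>, so this becomes
  \<open>2 c\<^sub>n\<^sub>-\<^sub>1 = n z c\<^sub>n'\<close>: the exponent is the integral of \<open>c\<^sub>n' / c\<^sub>n\<close>. The
  shape of the operator forces \<open>c\<^sub>n(0) = 1\<close>.
\<close>

section \<open>Coefficients of operators\<close>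

lemma op_coeff_add: "op_coeff (A + B) k = op_coeff A k + op_coeff B k"
  by (simp add: op_coeff_def plus_diffop.rep_eq)

lemma op_coeff_sum: "op_coeff (\<Sum>i\<in>S. f i) k = (\<Sum>i\<in>S. op_coeff (f i) k)"
  by (induction S rule: infinite_finite_induct)
     (simp_all add: op_coeff_add, simp_all add: op_coeff_def zero_diffop.rep_eq)

lemma op_coeff_uminus: "op_coeff (- A) k = - op_coeff A k"
  by (simp add: op_coeff_def uminus_diffop.rep_eq)

lemma op_coeff_minus_1_power_mult: "op_coeff ((-1) ^ i * L) k = (-1) ^ i * op_coeff L k"
  by (induction i) (simp_all add: op_coeff_uminus)

lemma op_coeff_mul_op: "op_coeff (mul_op a) k = (if k = 0 then a else 0)"
  by (simp add: op_coeff_def mul_op_def coeff_pCons split: nat.split)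

lemma op_coeff_mul_op_mult: "op_coeff (mul_op a * L) k = a * op_coeff L k"
  by (simp add: op_coeff_def mul_op_def times_diffop.rep_eq dcomp_def)

lemma op_coeff_D_op_mult:
  "op_coeff (D_op * L) k = (case k of 0 \<Rightarrow> 0 | Suc j \<Rightarrow> op_coeff L j) + fderiv (op_coeff L k)"
  using D_op_Diffop[of "coeffs_of L"]
  by (simp add: op_coeff_def coeffs_of_inverse dleft_def coeff_pCons split: nat.split)

lemma op_order_eqI:
  assumes "op_coeff L n \<noteq> 0" "\<And>k. k > n \<Longrightarrow> op_coeff L k = 0"
  shows "op_order L = n"
  using assms unfolding op_coeff_def op_order_def
  by (intro antisym degree_le le_degree) auto

lemma mul_op_power: "mul_op a ^ k = mul_op (a ^ k)"
  by (induction k) (simp_all add: mul_op_mult, simp add: mul_op_def one_diffop_def one_pCons)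

subsection \<open>Leading terms of a composition with a function and of the dual\<close>

lemma op_coeff_D_op_power_mul_op_above:
  "i < k \<Longrightarrow> op_coeff (D_op ^ i * mul_op a) k = 0"
  by (induction i arbitrary: k)
     (simp_all add: op_coeff_mul_op op_coeff_D_op_mult mult.assoc split: nat.split)

lemma op_coeff_D_op_power_mul_op_top: "op_coeff (D_op ^ i * mul_op a) i = a"
  by (induction i)
     (simp_all add: op_coeff_mul_op op_coeff_D_op_mult op_coeff_D_op_power_mul_op_above mult.assoc)

text \<open>This is the \<open>j = 1\<close> term of the Leibniz rule: moving one of the
  \<open>Suc i\<close> derivations onto \<open>a\<close> gives the binomial factor
  \<open>Suc i\<close>.\<close>

lemma op_coeff_D_op_power_mul_op_subtop:
  "op_coeff (D_op ^ Suc i * mul_op a) i = of_nat (Suc i) * fderiv a"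
proof (induction i)
  case 0
  show ?case by (simp add: op_coeff_mul_op op_coeff_D_op_mult)
next
  case (Suc i)
  have "op_coeff (D_op ^ Suc (Suc i) * mul_op a) (Suc i)
      = op_coeff (D_op ^ Suc i * mul_op a) i + fderiv (op_coeff (D_op ^ Suc i * mul_op a) (Suc i))"
    unfolding power_Suc[of _ "Suc i"] mult.assoc[of D_op]
    by (simp add: op_coeff_D_op_mult)
  then show ?case
    by (simp only: Suc.IH op_coeff_D_op_power_mul_op_top) (simp add: algebra_simps)
qed

text \<open>Summands of order below \<open>p\<close> do not reach \<partial>^p, so for an operator
  of order \<open>Suc p\<close> that coefficient comes from the last two alone.\<close>

lemma sum_atMost_Suc_eq_top_two:
  fixes f :: "nat \<Rightarrow> 'a::comm_monoid_add"
  assumes "\<And>i. i < p \<Longrightarrow> f i = 0"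
  shows "(\<Sum>i\<le>Suc p. f i) = f p + f (Suc p)"
proof -
  have "(\<Sum>i\<le>p. f i) = f p"
    using assms by (subst sum.remove[of _ p]) (auto intro!: sum.neutral)
  then show ?thesis by simp
qed

lemma op_coeff_mult_mul_op_subtop:
  assumes "op_order L = Suc p"
  shows "op_coeff (L * mul_op a) p
    = op_coeff L p * a + op_coeff L (Suc p) * (of_nat (Suc p) * fderiv a)"
proof -
  have "L * mul_op a = (\<Sum>i\<le>Suc p. mul_op (op_coeff L i) * (D_op ^ i * mul_op a))"
    by (subst diffop_expand[of L]) (simp only: assms sum_distrib_right mult.assoc)
  then have "op_coeff (L * mul_op a) p
      = (\<Sum>i\<le>Suc p. op_coeff L i * op_coeff (D_op ^ i * mul_op a) p)"
    by (simp only: op_coeff_sum op_coeff_mul_op_mult)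
  then show ?thesis
    by (simp only: sum_atMost_Suc_eq_top_two op_coeff_D_op_power_mul_op_above
        op_coeff_D_op_power_mul_op_top op_coeff_D_op_power_mul_op_subtop mult_zero_right)
qed

text \<open>The two surviving summands carry opposite signs; factoring out \<open>(-1) ^ p\<close>
  leaves the minus sign on the derivative term.\<close>

lemma op_coeff_dual_subtop:
  assumes "op_order L = Suc p"
  shows "op_coeff (dual L) p
    = (-1) ^ p * (op_coeff L p - of_nat (Suc p) * fderiv (op_coeff L (Suc p)))"
proof -
  have "op_coeff (dual L) p
      = (\<Sum>i\<le>Suc p. (-1) ^ i * op_coeff (D_op ^ i * mul_op (op_coeff L i)) p)"
    by (simp only: dual_def assms op_coeff_sum op_coeff_minus_1_power_mult mult.assoc)
  then show ?thesis
    by (simp only: sum_atMost_Suc_eq_top_two op_coeff_D_op_power_mul_op_above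
        op_coeff_D_op_power_mul_op_top op_coeff_D_op_power_mul_op_subtop mult_zero_right)
       (simp add: algebra_simps)
qed

subsection \<open>Leading terms of operators in \<open>\<vartheta>\<close>\<close>

abbreviation zf :: "complex poly fract"
  where "zf \<equiv> to_fract [:0, 1:]"

lemma to_fract_power: "to_fract (p ^ k) = to_fract p ^ k"
  by (induction k) simp_all

lemma to_fract_sum: "to_fract (\<Sum>i\<in>S. f i) = (\<Sum>i\<in>S. to_fract (f i))"
  by (induction S rule: infinite_finite_induct) simp_all

lemma to_fract_of_nat: "to_fract (of_nat k) = of_nat k"
  by (induction k) simp_all

lemma fderiv_zf: "fderiv zf = 1"
  by (simp add: fderiv_to_fract pderiv_pCons flip: one_pCons)

text \<open>Powers of \<open>z\<close> are eigenvectors of \<vartheta>. The extra factor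
  \<open>zf\<close> avoids the exponent \<open>i - 1\<close>.\<close>

lemma fderiv_zf_power_times: "zf * fderiv (zf ^ i) = of_nat i * zf ^ i"
proof (induction i)
  case (Suc i)
  then show ?case by (simp add: fderiv_mult fderiv_zf algebra_simps)
qed simp

lemma op_coeff_theta_mult:
  "op_coeff (theta * L) k
    = zf * ((case k of 0 \<Rightarrow> 0 | Suc j \<Rightarrow> op_coeff L j) + fderiv (op_coeff L k))"
  by (simp add: theta_def z_op_def mult.assoc op_coeff_mul_op_mult op_coeff_D_op_mult)

lemma op_coeff_one: "op_coeff 1 k = (if k = 0 then 1 else 0)"
  by (simp add: op_coeff_def one_diffop.rep_eq)

lemma op_coeff_theta_power_above: "i < k \<Longrightarrow> op_coeff (theta ^ i) k = 0"
  by (induction i arbitrary: k)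
     (simp_all add: op_coeff_one op_coeff_theta_mult split: nat.split)

lemma op_coeff_theta_power_top: "op_coeff (theta ^ i) i = zf ^ i"
  by (induction i) (simp_all add: op_coeff_one op_coeff_theta_mult op_coeff_theta_power_above)

text \<open>The factor is the Stirling number S(i+1, i), a binomial coefficient; doubling keeps
  division out of the induction.\<close>

lemma op_coeff_theta_power_subtop:
  "2 * op_coeff (theta ^ Suc i) i = of_nat (i * Suc i) * zf ^ i"
proof (induction i)
  case 0
  show ?case using op_coeff_theta_mult[of 1 0] by (simp add: op_coeff_one)
next
  case (Suc i)
  have "op_coeff (theta ^ Suc (Suc i)) (Suc i)
      = zf * op_coeff (theta ^ Suc i) i + zf * fderiv (zf ^ Suc i)"
    unfolding power_Suc[of theta "Suc i"]
    by (simp only: op_coeff_theta_mult op_coeff_theta_power_top nat.case ring_distribs)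
  then have "2 * op_coeff (theta ^ Suc (Suc i)) (Suc i)
      = zf * (2 * op_coeff (theta ^ Suc i) i) + 2 * (zf * fderiv (zf ^ Suc i))"
    by (simp only: ring_distribs mult.left_commute)
  also have "\<dots> = of_nat (i * Suc i) * zf ^ Suc i + 2 * (of_nat (Suc i) * zf ^ Suc i)"
    by (simp only: Suc.IH fderiv_zf_power_times) (simp add: algebra_simps)
  also have "\<dots> = of_nat (Suc i * Suc (Suc i)) * zf ^ Suc i"
    by (simp add: algebra_simps)
  finally show ?case .
qed

lemma op_coeff_theta_sum:
  "op_coeff (\<Sum>i\<le>N. pmul_op (c i) * theta ^ i) k
    = (\<Sum>i\<le>N. to_fract (c i) * op_coeff (theta ^ i) k)"
  by (simp add: op_coeff_sum op_coeff_mul_op_mult)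

lemma op_coeff_theta_sum_above:
  "N < k \<Longrightarrow> op_coeff (\<Sum>i\<le>N. pmul_op (c i) * theta ^ i) k = 0"
  by (simp add: op_coeff_theta_sum op_coeff_theta_power_above)

lemma op_coeff_theta_sum_top:
  "op_coeff (\<Sum>i\<le>N. pmul_op (c i) * theta ^ i) N = to_fract (c N) * zf ^ N"
  unfolding op_coeff_theta_sum
  by (subst sum.remove[of _ N])
     (auto intro!: sum.neutral simp: op_coeff_theta_power_above op_coeff_theta_power_top)

lemma op_coeff_theta_sum_subtop:
  "2 * op_coeff (\<Sum>i\<le>Suc p. pmul_op (c i) * theta ^ i) p
    = (2 * to_fract (c p) + of_nat (p * Suc p) * to_fract (c (Suc p))) * zf ^ p"
proof -
  have "op_coeff (\<Sum>i\<le>Suc p. pmul_op (c i) * theta ^ i) p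
      = to_fract (c p) * zf ^ p + to_fract (c (Suc p)) * op_coeff (theta ^ Suc p) p"
    by (simp only: op_coeff_theta_sum sum_atMost_Suc_eq_top_two op_coeff_theta_power_above
        op_coeff_theta_power_top mult_zero_right)
  then have "2 * op_coeff (\<Sum>i\<le>Suc p. pmul_op (c i) * theta ^ i) p
      = 2 * to_fract (c p) * zf ^ p + to_fract (c (Suc p)) * (2 * op_coeff (theta ^ Suc p) p)"
    by (simp only: ring_distribs mult.left_commute mult.assoc)
  then show ?thesis
    by (simp only: op_coeff_theta_power_subtop) (simp only: ring_distribs mult_ac)
qed

lemma op_coeff_poly_op_theta:
  assumes "degree p \<le> n"
  shows "op_coeff (poly_op p theta) n = to_fract [:coeff p n:] * zf ^ n"
proof (cases "degree p = n")
  case True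
  then show ?thesis
    using op_coeff_theta_sum_top[of "\<lambda>i. [:coeff p i:]" n] by (simp add: poly_op_def)
next
  case False
  with assms have "degree p < n" by simp
  then show ?thesis
    using op_coeff_theta_sum_above[of "degree p" n "\<lambda>i. [:coeff p i:]"]
    by (simp add: poly_op_def coeff_eq_0)
qed

text \<open>Both expansions of the operator are compared at \<partial>^n. There \<vartheta>^n
  contributes 1 and every other term keeps a factor \<open>z\<close>, which is what later yields the
  value 1 at 0.\<close>

lemma leading_theta_coeff:
  assumes "\<And>k. 1 \<le> k \<Longrightarrow> k \<le> m \<Longrightarrow> degree (Pk k) \<le> n"
    and "theta ^ n + (\<Sum>k=1..m. z_op ^ k * poly_op (Pk k) theta)
      = (\<Sum>i\<le>n. pmul_op (c i) * theta ^ i)"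
  shows "c n = 1 + (\<Sum>k=1..m. [:0, 1:] ^ k * [:coeff (Pk k) n:])"
proof -
  have "to_fract (c n) * zf ^ n
      = zf ^ n + (\<Sum>k=1..m. zf ^ k * (to_fract [:coeff (Pk k) n:] * zf ^ n))"
    using assms(1)
    by (simp add: op_coeff_add op_coeff_sum op_coeff_theta_power_top z_op_def mul_op_power
        op_coeff_mul_op_mult op_coeff_poly_op_theta flip: op_coeff_theta_sum_top assms(2))
  also have "\<dots> = to_fract (1 + (\<Sum>k=1..m. [:0, 1:] ^ k * [:coeff (Pk k) n:])) * zf ^ n"
    by (simp only: to_fract_add to_fract_sum to_fract_mult to_fract_power to_fract_1
        ring_distribs sum_distrib_right mult.assoc mult_1)
  \<comment> \<open>The common factor \<open>zf ^ n\<close> is nonzero and cancels.\<close>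
  finally have "to_fract (c n) = to_fract (1 + (\<Sum>k=1..m. [:0, 1:] ^ k * [:coeff (Pk k) n:]))"
    by (rule mult_right_cancel[THEN iffD1, rotated]) simp
  then show ?thesis by (simp only: to_fract_eq_iff)
qed

section \<open>The differential equation for the leading coefficient\<close>

text \<open>At \<partial>^(p+1) both sides agree automatically, so \<partial>^p gives the first
  condition. The signs \<open>(-1) ^ Suc p\<close> and \<open>(-1) ^ p\<close> combine to -1, hence
  the two \<open>op_coeff L p\<close> terms add up rather than cancel.\<close>

lemma self_dual_subleading:
  assumes order: "op_order L = Suc p"
    and dual: "L * z_op = (-1) ^ Suc p * z_op * dual L"
  shows "of_nat (Suc p) * op_coeff L (Suc p) + 2 * zf * op_coeff L p
    = of_nat (Suc p) * zf * fderiv (op_coeff L (Suc p))"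
proof -
  have "op_coeff (L * mul_op zf) p = (-1) ^ Suc p * (zf * op_coeff (dual L) p)"
    using arg_cong[OF dual, of "\<lambda>L. op_coeff L p"]
    by (simp only: z_op_def mult.assoc op_coeff_minus_1_power_mult op_coeff_mul_op_mult)
  moreover have "(-1) ^ p * ((-1) ^ p * x) = (x :: complex poly fract)" for x
    by (simp add: mult.assoc[symmetric] power_mult_distrib[symmetric])
  ultimately show ?thesis
    unfolding op_coeff_mult_mul_op_subtop[OF order] op_coeff_dual_subtop[OF order]
    by (simp add: fderiv_zf algebra_simps)
qed

lemma self_dual_theta_coeffs:
  assumes L: "L = (\<Sum>i\<le>Suc p. pmul_op (c i) * theta ^ i)"
    and dual: "L * z_op = (-1) ^ Suc p * z_op * dual L"
    and nz: "c (Suc p) \<noteq> 0"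
  shows "2 * c p = of_nat (Suc p) * [:0, 1:] * pderiv (c (Suc p))"
proof -
  let ?c = "to_fract (c (Suc p))" and ?n = "of_nat (Suc p) :: complex poly fract"
  have top: "op_coeff L (Suc p) = ?c * zf ^ Suc p"
    unfolding L by (rule op_coeff_theta_sum_top)
  \<comment> \<open>The sum defining \<open>dual\<close> runs up to the actual order, so the top
    coefficient must be nonzero.\<close>
  have order: "op_order L = Suc p"
  proof (rule op_order_eqI)
    show "op_coeff L (Suc p) \<noteq> 0" using nz by (simp add: top)
    show "op_coeff L k = 0" if "Suc p < k" for k
      unfolding L using that by (rule op_coeff_theta_sum_above)
  qed
  have sub: "2 * op_coeff L p = (2 * to_fract (c p) + of_nat (p * Suc p) * ?c) * zf ^ p"
    unfolding L by (rule op_coeff_theta_sum_subtop)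
  have "zf * fderiv (?c * zf ^ Suc p) = zf * fderiv ?c * zf ^ Suc p + ?c * (zf * fderiv (zf ^ Suc p))"
    by (simp only: fderiv_mult ring_distribs mult_ac)
  also have "\<dots> = (zf * fderiv ?c + ?n * ?c) * zf ^ Suc p"
    by (simp only: fderiv_zf_power_times ring_distribs mult_ac)
  finally have der: "zf * fderiv (?c * zf ^ Suc p) = (zf * fderiv ?c + ?n * ?c) * zf ^ Suc p" .
  \<comment> \<open>The 2 is grouped with \<open>op_coeff L p\<close> so that \<open>sub\<close>
    rewrites without halving.\<close>
  have "?n * (?c * zf ^ Suc p) + zf * (2 * op_coeff L p) = ?n * (zf * fderiv (?c * zf ^ Suc p))"
    using self_dual_subleading[OF order dual] unfolding top by (simp only: mult_ac)
  then have "(?n * ?c + (2 * to_fract (c p) + of_nat (p * Suc p) * ?c)) * zf ^ Suc p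
      = ?n * (zf * fderiv ?c + ?n * ?c) * zf ^ Suc p"
    unfolding der sub by (simp only: power_Suc ring_distribs mult_ac)
  then have "?n * ?c + (2 * to_fract (c p) + of_nat (p * Suc p) * ?c)
      = ?n * (zf * fderiv ?c + ?n * ?c)"
    by (rule mult_right_cancel[THEN iffD1, rotated]) simp
  \<comment> \<open>With n = p + 1, n + p n = n^2, so all multiples of \<open>?c\<close> itself
    cancel.\<close>
  then have "2 * to_fract (c p) = ?n * zf * fderiv ?c"
    by (simp add: algebra_simps)
  moreover have "to_fract (2 :: complex poly) = 2"
    by (metis to_fract_of_nat of_nat_numeral)
  ultimately have "to_fract (2 * c p) = to_fract (of_nat (Suc p) * [:0, 1:] * pderiv (c (Suc p)))"
    by (simp only: to_fract_mult to_fract_of_nat fderiv_to_fract)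
  then show ?thesis by (simp only: to_fract_eq_iff)
qed

section \<open>The exponential of the integral\<close>

text \<open>No branch of the logarithm is chosen: \<open>q\<close> maps the segment to a curve
  avoiding 0, and the exponential of the integral of g'/g along it is the quotient of its
  endpoints.\<close>

lemma exp_contour_integral_log_deriv:
  assumes nz: "\<And>w. w \<in> closed_segment a b \<Longrightarrow> poly q w \<noteq> 0"
  shows "(\<lambda>w. poly (pderiv q) w / poly q w) contour_integrable_on linepath a b"
    and "exp (contour_integral (linepath a b) (\<lambda>w. poly (pderiv q) w / poly q w))
      = poly q b / poly q a"
proof -
  let ?f = "\<lambda>w. poly (pderiv q) w / poly q w"
  let ?g = "\<lambda>t. poly q (linepath a b t)"
  show "?f contour_integrable_on linepath a b"
    by (intro contour_integrable_continuous_linepath continuous_intros ballI nz)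
  have vd: "(?g has_vector_derivative (b - a) * poly (pderiv q) (linepath a b t)) (at t)" for t
    using field_vector_diff_chain_at[OF has_vector_derivative_linepath_within[of a b t UNIV]
        poly_DERIV[of q "linepath a b t"]]
    by (simp add: o_def)
  have "?g C1_differentiable_on {0..1}"
    unfolding C1_differentiable_on_def
    by (intro exI[of _ "\<lambda>t. (b - a) * poly (pderiv q) (linepath a b t)"] conjI ballI vd
        continuous_intros continuous_on_linepath)
  then have "?g piecewise_C1_differentiable_on {0..1}"
    by (rule C1_differentiable_imp_piecewise)
  moreover have "0 \<notin> ?g ` {0..1}"
    using nz linepath_in_path by fastforce
  ultimately have "exp (- integral {0..1} (\<lambda>t. vector_derivative ?g (at t) / (?g t - 0))) * (?g 1 - 0)
      = ?g 0 - 0"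
    by (intro winding_number_exp_integral(2)) simp_all
  moreover have "integral {0..1} (\<lambda>t. vector_derivative ?g (at t) / (?g t - 0))
      = contour_integral (linepath a b) ?f"
    by (simp add: contour_integral_integral vector_derivative_at[OF vd] mult_ac)
  ultimately show "exp (contour_integral (linepath a b) ?f) = poly q b / poly q a"
    using nz[of a] by (simp add: exp_minus linepath_def field_simps)
qed

text \<open>
  Needed because \<open>P_integrand\<close> has the junk value \<open>0\<close> at the starting point \<open>0\<close> of the path.
\<close>

lemma has_contour_integral_linepath_spike:
  assumes "(f has_contour_integral I) (linepath a b)" and "\<And>w. w \<noteq> a \<Longrightarrow> g w = f w"
  shows "(g has_contour_integral I) (linepath a b)"
proof (cases "a = b")
  case True
  with assms(1) show ?thesis by simp
next
  case False
  \<comment> \<open>A nondegenerate segment meets \<open>a\<close> only at \<open>t = 0\<close>, a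
    single parameter that the integral ignores.\<close>
  have "linepath a b t \<noteq> a" if "t \<noteq> 0" for t
    using False that by (simp add: linepath_def algebra_simps flip: scaleR_diff_right)
  with assms(2) have spike: "g (linepath a b t) = f (linepath a b t)" if "t \<noteq> 0" for t
    using that by blast
  show ?thesis
    unfolding has_contour_integral_linepath
  proof (rule has_integral_spike_finite)
    show "finite {0 :: real}" by simp
    show "g (linepath a b t) * (b - a) = f (linepath a b t) * (b - a)" if "t \<in> {0..1} - {0}" for t
      using that by (simp add: spike)
    show "((\<lambda>t. f (linepath a b t) * (b - a)) has_integral I) {0..1}"
      using assms(1) by (simp only: has_contour_integral_linepath)
  qed
qed

theorem mainTheorem4:
  fixes n m :: nat
    and Pk c :: "nat \<Rightarrow> complex poly"
    and \<D> :: diffop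
  assumes "n \<ge> 1"
    and "\<And>k. 1 \<le> k \<Longrightarrow> k \<le> m \<Longrightarrow> degree (Pk k) \<le> n"
    and "\<D> = theta ^ n + (\<Sum>k=1..m. z_op ^ k * poly_op (Pk k) theta)"
    and "\<D> = (\<Sum>i\<le>n. pmul_op (c i) * theta ^ i)"
    and "\<D> * z_op = (-1) ^ n * z_op * dual \<D>"
  shows "P_fun n c 0 = 1 \<and> poly (c n) 0 \<noteq> 0 \<and>
    (\<forall>z. (\<forall>w\<in>closed_segment 0 z. poly (c n) w \<noteq> 0) \<longrightarrow>
         P_integrand n c contour_integrable_on linepath 0 z \<and>
         P_fun n c z = poly (c n) z)"
proof (intro conjI allI impI)
  have "c n = 1 + (\<Sum>k=1..m. [:0, 1:] ^ k * [:coeff (Pk k) n:])"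
    by (rule leading_theta_coeff[OF assms(2) trans[OF assms(3)[symmetric] assms(4)]])
  \<comment> \<open>All summands have \<open>k \<ge> 1\<close>, so they vanish at 0.\<close>
  then have c0: "poly (c n) 0 = 1"
    by (auto simp: poly_sum intro!: sum.neutral)
  then show "poly (c n) 0 \<noteq> 0" by simp
  show "P_fun n c 0 = 1" by (simp add: P_fun_def)
  obtain p where n: "n = Suc p" using assms(1) by (cases n) auto
  have "c n \<noteq> 0" using c0 by auto
  with assms(4,5) have ode: "2 * c p = of_nat n * [:0, 1:] * pderiv (c n)"
    unfolding n by (rule self_dual_theta_coeffs)
  have eq: "poly (c p) w = of_nat n * w * poly (pderiv (c n)) w / 2" for w
    using arg_cong[OF ode, of "\<lambda>q. poly q w"] by (simp add: mult_ac)
  let ?f = "\<lambda>w. poly (pderiv (c n)) w / poly (c n) w"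
  \<comment> \<open>The factor \<open>w\<close> from the differential equation cancels the pole at
    0.\<close>
  have integrand: "P_integrand n c w = of_nat n / 2 * ?f w" if "w \<noteq> 0" for w
  proof -
    have "P_integrand n c w = poly (c p) w / (w * poly (c n) w)"
      by (simp add: P_integrand_def n)
    with that show ?thesis by (simp add: eq)
  qed
  fix z assume "\<forall>w\<in>closed_segment 0 z. poly (c n) w \<noteq> 0"
  then have nz: "\<And>w. w \<in> closed_segment 0 z \<Longrightarrow> poly (c n) w \<noteq> 0" by blast
  note f = exp_contour_integral_log_deriv[OF nz]
  have "((\<lambda>w. of_nat n / 2 * ?f w) has_contour_integral
      of_nat n / 2 * contour_integral (linepath 0 z) ?f) (linepath 0 z)"
    using f(1) by (intro has_contour_integral_lmul has_contour_integral_integral)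
  then have int: "(P_integrand n c has_contour_integral
      of_nat n / 2 * contour_integral (linepath 0 z) ?f) (linepath 0 z)"
    by (rule has_contour_integral_linepath_spike) (rule integrand)
  then show "P_integrand n c contour_integrable_on linepath 0 z"
    by (rule has_contour_integral_integrable)
  \<comment> \<open>The factors 2/n and n/2 cancel, and \<open>c0\<close> turns the endpoint
    quotient into \<open>poly (c n) z\<close>.\<close>
  show "P_fun n c z = poly (c n) z"
    using f(2) assms(1) by (simp add: P_fun_def contour_integral_unique[OF int] c0)
qed

end
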